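(* The optimal guessing strategy for $k$ riffle shuffles need not be the same as the optimal strategy for one riffle shuffle. Precisely: there exist integers $n\ge 1$ and $k\ge 2$ such that no guessing strategy that is optimal for an $n$-card deck after $k$ riffle shuffles follows the longer-subsequence rule.
   Context: Riffle shuffle (Gilbert–Shannon–Reeds model): a deck of $n$ cards is cut so that the top pile consists of the top $t$ cards with probability $\binom{n}{t}/2^n$ ($0\le t\le n$); then the two piles are interleaved into a single deck, keeping the relative order inside each pile, all $\binom nt$ interleavings being equally likely. Performing $k$ riffle shuffles means starting with the deck ordered $1,\dots,n$ from top to bottom and applying $k$ independent riffle shuffles successively. Game with complete feedback: after the shuffling, the player guesses the cards one at a time from the top; after each guess the identity of that card is revealed. A guessing strategy is a function assigning to each history $S=(s_1,\dots,s_r)$, $0\le r<n$, of revealed cards the guess for the next card. A strategy is optimal for $k$ shuffles of $n$ cards if it maximizes the expected total number of correct guesses, when the deck has the distribution of $k$ riffle shuffles. Longer-subsequence rule (the optimal strategy for one riffle shuffle): a strategy follows this rule if, for every history $S$ that occurs with positive probability after a single riffle shuffle of the $n$ cards: - if $S=(1,2,\dots,j)$ with $0\le j<n$, the guess is $j+1$ (in particular the first guess is card $1$); - if $S=(1,2,\dots,j,m,\dots)$ with $j\ge0$ and $m\ne j+1$, then the remaining cards form two increasing subsequences, namely the not yet revealed cards of $\{j+1,\dots,m-1\}$ and the not yet revealed cards of $\{m+1,\dots,n\}$, and the guess is the first (smallest) card of the longer of these two subsequences (either one in case of equal lengths). *)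

theory Defs
  imports "HOL-Probability.Probability"
begin

text \<open>
  Decks are lists, with the top card first.  For a deck without repeated cards, the two lemmas
  after the definition of \<open>riffle_shuffle\<close> give its cut probabilities and the number of
  interleavings of the two piles.
\<close>

definition riffle_shuffle :: "'a list \<Rightarrow> 'a list pmf" where
  "riffle_shuffle xs =
     bind_pmf (binomial_pmf (length xs) (1/2))
       (\<lambda>t. pmf_of_set (shuffles (take t xs) (drop t xs)))"

lemma cut_probability:
  assumes "t \<le> n"
  shows "pmf (binomial_pmf n (1/2)) t = real (n choose t) / 2 ^ n"
proof -
  have "(1/2 :: real) ^ t * (1/2) ^ (n - t) = 1 / 2 ^ n"
    using assms by (simp flip: power_add add: power_one_over)
  then show ?thesis using assms by (simp add: mult.assoc)
qed

lemma card_interleavings: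
  assumes "distinct xs" "t \<le> length xs"
  shows "card (shuffles (take t xs) (drop t xs)) = length xs choose t"
proof -
  have "set (take t xs) \<inter> set (drop t xs) = {}"
    using assms(1) by (simp add: set_take_disj_set_drop_if_distinct)
  then show ?thesis using assms by (simp add: card_disjoint_shuffles)
qed

primrec riffle_shuffles :: "nat \<Rightarrow> 'a list \<Rightarrow> 'a list pmf" where
  "riffle_shuffles 0 xs = return_pmf xs"
| "riffle_shuffles (Suc k) xs = bind_pmf (riffle_shuffles k xs) riffle_shuffle"

definition deck_after :: "nat \<Rightarrow> nat \<Rightarrow> nat list pmf" where
  "deck_after k n = riffle_shuffles k [1..<Suc n]"

definition histories :: "nat \<Rightarrow> nat list set" where
  "histories n = {S. length S < n \<and> distinct S \<and> set S \<subseteq> {1..n}}"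

text \<open>
  A strategy is a total function whose values outside \<open>histories n\<close> are irrelevant.
\<close>

definition strategies :: "nat \<Rightarrow> (nat list \<Rightarrow> nat) set" where
  "strategies n = histories n \<rightarrow> {1..n}"

definition correct_guesses :: "('a list \<Rightarrow> 'a) \<Rightarrow> 'a list \<Rightarrow> nat" where
  "correct_guesses G d = card {r. r < length d \<and> G (take r d) = d ! r}"

definition expected_correct :: "nat \<Rightarrow> nat \<Rightarrow> (nat list \<Rightarrow> nat) \<Rightarrow> real" where
  "expected_correct k n G =
     measure_pmf.expectation (deck_after k n) (\<lambda>d. real (correct_guesses G d))"

definition optimal_strategy :: "nat \<Rightarrow> nat \<Rightarrow> (nat list \<Rightarrow> nat) \<Rightarrow> bool" where
  "optimal_strategy k n G \<longleftrightarrow>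
     G \<in> strategies n \<and> (\<forall>G' \<in> strategies n. expected_correct k n G' \<le> expected_correct k n G)"

definition possible_history :: "nat \<Rightarrow> nat list \<Rightarrow> bool" where
  "possible_history n S \<longleftrightarrow>
     S \<in> histories n \<and>
     measure_pmf.prob (deck_after 1 n) {d. take (length S) d = S} > 0"

text \<open>
  In the second clause below, \<open>A\<close> and \<open>B\<close> are the unrevealed cards of the two increasing
  subsequences; since some card is still unrevealed, the longer one is never empty, so
  \<open>Min\<close> is only taken of nonempty sets.
\<close>

definition follows_longer_subsequence_rule :: "nat \<Rightarrow> (nat list \<Rightarrow> nat) \<Rightarrow> bool" where
  "follows_longer_subsequence_rule n G \<longleftrightarrow>
     (\<forall>S. possible_history n S \<longrightarrow>
        (\<forall>j. S = [1..<Suc j] \<longrightarrow> G S = j + 1) \<and>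
        (\<forall>j m T. S = [1..<Suc j] @ m # T \<and> m \<noteq> j + 1 \<longrightarrow>
           (let A = {j + 1..<m} - set S; B = {m + 1..n} - set S in
              (card A > card B \<longrightarrow> G S = Min A) \<and>
              (card A < card B \<longrightarrow> G S = Min B) \<and>
              (card A = card B \<longrightarrow> G S = Min A \<or> G S = Min B))))"

lemma set_riffle_shuffle:
  "set_pmf (riffle_shuffle xs) = (\<Union>t\<le>length xs. shuffles (take t xs) (drop t xs))"
proof -
  have "set_pmf (pmf_of_set (shuffles as bs)) = shuffles as bs" for as bs :: "'a list"
    by (rule set_pmf_of_set) (auto simp: splice_in_shuffles intro: exI[of _ "splice as bs"])
  then show ?thesis
    by (simp add: riffle_shuffle_def set_pmf_binomial_eq)
qed

lemma finite_set_deck_after: "finite (set_pmf (deck_after k n))"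
proof -
  have "finite (set_pmf (riffle_shuffle xs))" for xs :: "nat list"
    by (simp add: set_riffle_shuffle)
  then have "finite (set_pmf (riffle_shuffles k xs))" for xs :: "nat list"
    by (induction k) auto
  then show ?thesis by (simp add: deck_after_def)
qed

lemma set_deck_after_length:
  assumes "d \<in> set_pmf (deck_after k n)"
  shows "length d = n"
proof -
  have one: "length ys = length xs" if "ys \<in> set_pmf (riffle_shuffle xs)" for xs ys :: "nat list"
    using that by (auto simp: set_riffle_shuffle dest!: length_shuffles)
  have "length ys = length xs" if "ys \<in> set_pmf (riffle_shuffles k xs)" for xs ys :: "nat list"
    using that by (induction k arbitrary: ys) (auto dest: one)
  from this[of d "[1..<Suc n]"] show ?thesis using assms by (simp add: deck_after_def)
qed

text \<open>The notion of optimality is not vacuous.\<close>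

lemma optimal_strategy_exists:
  assumes "n \<ge> 1"
  shows "\<exists>G. optimal_strategy k n G"
proof -
  let ?D = "set_pmf (deck_after k n)"
  let ?F = "\<lambda>G. restrict (correct_guesses G) ?D"
  let ?E = "\<lambda>f. measure_pmf.expectation (deck_after k n) (\<lambda>d. real (f d))"
  have E: "expected_correct k n G = ?E (?F G)" for G
    unfolding expected_correct_def
    by (intro integral_cong_AE) (auto simp: AE_measure_pmf_iff)
  have bound: "correct_guesses G d \<le> length d" for G and d :: "nat list"
  proof -
    have "card {r. r < length d \<and> G (take r d) = d ! r} \<le> card {..<length d}"
      by (intro card_mono) auto
    then show ?thesis by (simp add: correct_guesses_def)
  qed
  have "?F ` strategies n \<subseteq> ?D \<rightarrow>\<^sub>E {..n}"
    using bound set_deck_after_length by fastforce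
  moreover have "finite (?D \<rightarrow>\<^sub>E {..n})"
    using finite_set_deck_after by (intro finite_PiE) auto
  ultimately have "finite (?E ` ?F ` strategies n)"
    using finite_subset by blast
  then have fin: "finite (expected_correct k n ` strategies n)"
    unfolding image_image E[symmetric] .
  have "(\<lambda>_. 1) \<in> strategies n"
    using assms by (auto simp: strategies_def)
  then have ne: "expected_correct k n ` strategies n \<noteq> {}" by blast
  from Max_in[OF fin ne] obtain G where "G \<in> strategies n"
    "expected_correct k n G = Max (expected_correct k n ` strategies n)" by auto
  then show ?thesis
    unfolding optimal_strategy_def using Max_ge[OF fin] by (metis image_eqI)
qed

end

theory Submission
  imports Defs
begin

text \<open>
  The witness is \<open>n = 10\<close>, \<open>k = 2\<close> with the history \<open>[5]\<close>.  The unrevealed cards split into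
  \<open>1, 2, 3, 4\<close> and \<open>6, 7, 8, 9, 10\<close>, so the rule guesses \<open>6\<close>.  After two shuffles, however, the two
  top cards are \<open>5, 1\<close> with probability \<open>31752 / 4 ^ 10\<close> and \<open>5, 6\<close> with probability only
  \<open>31570 / 4 ^ 10\<close>.  A strategy that guesses \<open>6\<close> gains by guessing \<open>1\<close> at this single history
  (\<open>optimal_strategy_best_guess\<close>), hence it is not optimal.

  The probabilities come from the description of \<open>k\<close> riffle shuffles as one shuffle with \<open>2 ^ k\<close> piles
  (\<open>riffle_shuffles_deal\<close>).  Give every position of the final deck an independent uniform digit
  below \<open>2 ^ k\<close>, naming the pile from which its card is taken.  The positions with digit \<open>0\<close> receive
  the top cards in order, those with digit \<open>1\<close> the next ones, and so on; that is, position \<open>i\<close>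
  receives the card whose index is the rank of \<open>i\<close> in the stable sort of the digits.  Performing a
  further shuffle refines every digit by one binary digit, because the rank of a rank is the rank in
  the lexicographic order (\<open>stable_rank_refine\<close>).

  The top two cards then depend on the first two digits \<open>x\<close>, \<open>y\<close> and on how many of the other digits
  lie below \<open>x\<close> and below \<open>y\<close>.  With \<open>K\<close> piles and ten cards, \<open>5, 1\<close> arises from
  \<open>(8 choose 3) * (x - y) ^ 3 * (K - x) ^ 5\<close> words for each \<open>y < x\<close>, and \<open>5, 6\<close> from
  \<open>(8 choose 4) * x ^ 4 * (K - y) ^ 4\<close> words for each \<open>y \<ge> x\<close>.  For \<open>K = 2\<close> the totals are \<open>56\<close> and
  \<open>70\<close>, in agreement with the rule; for \<open>K = 4\<close> they are \<open>56 * 567\<close> and \<open>70 * 451\<close>, and the order is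
  reversed.
\<close>

section \<open>Counting words\<close>

definition words :: "nat \<Rightarrow> 'a set \<Rightarrow> 'a list set" where
  "words n X = {w. set w \<subseteq> X \<and> length w = n}"

lemma finite_words: "finite X \<Longrightarrow> finite (words n X)"
  unfolding words_def by (rule finite_lists_length_eq)

lemma card_words: "finite X \<Longrightarrow> card (words n X) = card X ^ n"
  unfolding words_def by (rule card_lists_length_eq)

lemma nth_words_less: "w \<in> words n {..<K} \<Longrightarrow> i < n \<Longrightarrow> w ! i < K"
  unfolding words_def using nth_mem by blast

lemma words_nonempty: "X \<noteq> {} \<Longrightarrow> words n X \<noteq> {}"
proof -
  assume "X \<noteq> {}"
  then obtain x where "x \<in> X" by auto
  then have "replicate n x \<in> words n X" by (auto simp: words_def)
  then show ?thesis by auto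
qed

lemma card_words_Suc:
  assumes "finite X"
  shows "card {w \<in> words (Suc n) X. P w} = (\<Sum>x\<in>X. card {w \<in> words n X. P (x # w)})"
proof -
  have "{w \<in> words (Suc n) X. P w} =
      (\<lambda>(x, w). x # w) ` (SIGMA x:X. {w \<in> words n X. P (x # w)})"
    by (auto simp: words_def length_Suc_conv image_iff)
  then have "card {w \<in> words (Suc n) X. P w} = card (SIGMA x:X. {w \<in> words n X. P (x # w)})"
    by (auto simp: card_image inj_on_def)
  also have "\<dots> = (\<Sum>x\<in>X. card {w \<in> words n X. P (x # w)})"
    using assms by (intro card_SigmaI) (auto simp: finite_words)
  finally show ?thesis .
qed

lemma card_words_filter:
  assumes "finite Y" "finite Z" "Y \<inter> Z = {}"
  shows "card {w \<in> words n (Y \<union> Z). length (filter (\<lambda>x. x \<in> Y) w) = p} =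
    (n choose p) * card Y ^ p * card Z ^ (n - p)"
proof (induction n arbitrary: p)
  case 0
  have "{w \<in> words 0 (Y \<union> Z). length (filter (\<lambda>x. x \<in> Y) w) = p} = (if p = 0 then {[]} else {})"
    by (auto simp: words_def)
  then show ?case by simp
next
  case (Suc n)
  let ?C = "\<lambda>p. card {w \<in> words n (Y \<union> Z). length (filter (\<lambda>x. x \<in> Y) w) = p}"
  have "card {w \<in> words (Suc n) (Y \<union> Z). length (filter (\<lambda>x. x \<in> Y) w) = p} =
      (\<Sum>x\<in>Y \<union> Z. card {w \<in> words n (Y \<union> Z). length (filter (\<lambda>x. x \<in> Y) (x # w)) = p})"
    using assms by (intro card_words_Suc) simp
  also have "\<dots> = (\<Sum>x\<in>Y. card {w \<in> words n (Y \<union> Z). length (filter (\<lambda>x. x \<in> Y) (x # w)) = p})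
      + (\<Sum>x\<in>Z. card {w \<in> words n (Y \<union> Z). length (filter (\<lambda>x. x \<in> Y) (x # w)) = p})"
    using assms by (intro sum.union_disjoint) auto
  also have "(\<Sum>x\<in>Y. card {w \<in> words n (Y \<union> Z). length (filter (\<lambda>x. x \<in> Y) (x # w)) = p}) =
      (case p of 0 \<Rightarrow> 0 | Suc q \<Rightarrow> card Y * ?C q)"
    by (cases p) simp_all
  also have "(\<Sum>x\<in>Z. card {w \<in> words n (Y \<union> Z). length (filter (\<lambda>x. x \<in> Y) (x # w)) = p}) =
      (\<Sum>x\<in>Z. ?C p)"
  proof (intro sum.cong refl)
    fix x assume "x \<in> Z"
    then have "x \<notin> Y" using assms(3) by auto
    then show "card {w \<in> words n (Y \<union> Z). length (filter (\<lambda>x. x \<in> Y) (x # w)) = p} = ?C p"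
      by simp
  qed
  finally have step: "card {w \<in> words (Suc n) (Y \<union> Z). length (filter (\<lambda>x. x \<in> Y) w) = p} =
      (case p of 0 \<Rightarrow> 0 | Suc q \<Rightarrow> card Y * ?C q) + card Z * ?C p" by simp
  show ?case
  proof (cases p)
    case 0
    then show ?thesis unfolding step Suc.IH by simp
  next
    case (Suc q)
    have "card Z * ((n choose p) * card Y ^ p * card Z ^ (n - p)) =
        (n choose p) * card Y ^ p * card Z ^ (n - q)"
    proof (cases "p \<le> n")
      case True
      then have "n - q = Suc (n - p)" using Suc by simp
      then show ?thesis by simp
    qed simp
    then show ?thesis unfolding step Suc.IH using Suc by (simp add: algebra_simps)
  qed
qed

section \<open>The stable sorting rank\<close>

text \<open>
  The position at which the entry with index \<open>i\<close> ends up when \<open>w\<close> is sorted stably: entries are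
  compared by value, and equal entries by index.
\<close>

definition stable_rank :: "'a::linorder list \<Rightarrow> nat \<Rightarrow> nat" where
  "stable_rank w i = card {j. j < length w \<and> (w ! j < w ! i \<or> w ! j = w ! i \<and> j < i)}"

lemma stable_rank_mono_iff:
  assumes "i < length w" "j < length w"
  shows "stable_rank w j < stable_rank w i \<longleftrightarrow> w ! j < w ! i \<or> w ! j = w ! i \<and> j < i"
proof -
  let ?L = "\<lambda>i. {j. j < length w \<and> (w ! j < w ! i \<or> w ! j = w ! i \<and> j < i)}"
  have less: "stable_rank w j < stable_rank w i"
    if "j < length w" "w ! j < w ! i \<or> w ! j = w ! i \<and> j < i" for i j
  proof -
    have "?L j \<subset> ?L i" using that by auto
    then show ?thesis unfolding stable_rank_def by (intro psubset_card_mono) auto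
  qed
  show ?thesis
    using less[of j i] less[of i j] assms by (metis linorder_neqE order_less_asym)
qed

lemma bij_stable_rank: "bij_betw (stable_rank w) {..<length w} {..<length w}"
proof -
  have "inj_on (stable_rank w) {..<length w}"
  proof (rule inj_onI)
    fix i j assume "i \<in> {..<length w}" "j \<in> {..<length w}" "stable_rank w i = stable_rank w j"
    then show "i = j"
      using stable_rank_mono_iff[of i w j] stable_rank_mono_iff[of j w i] by (metis lessThan_iff linorder_neqE nat_neq_iff)
  qed
  moreover have "stable_rank w i < length w" if "i < length w" for i
  proof -
    have "{j. j < length w \<and> (w ! j < w ! i \<or> w ! j = w ! i \<and> j < i)} \<subset> {..<length w}"
      using that by auto
    then have "stable_rank w i < card {..<length w}" unfolding stable_rank_def by (intro psubset_card_mono) auto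
    then show ?thesis by simp
  qed
  then have "stable_rank w ` {..<length w} \<subseteq> {..<length w}" by auto
  ultimately show ?thesis
    unfolding bij_betw_def by (simp add: endo_inj_surj)
qed

lemma stable_rank_less: "i < length w \<Longrightarrow> stable_rank w i < length w"
  using bij_stable_rank[of w] by (auto simp: bij_betw_def)

lemma stable_rank_inj: "i < length w \<Longrightarrow> j < length w \<Longrightarrow> stable_rank w i = stable_rank w j \<longleftrightarrow> i = j"
  using bij_stable_rank[of w] by (auto simp: bij_betw_def inj_on_def)

text \<open>
  The word \<open>w\<close> names, for every position of the new deck, the pile that supplies its card; the pile
  sizes are the digit counts of \<open>w\<close>, and piles are cut from \<open>xs\<close> from the top.  Within a pile the
  order is kept, so the ties in the rank are broken by position.
\<close>

definition deal :: "'a list \<Rightarrow> nat list \<Rightarrow> 'a list" where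
  "deal xs w = map (\<lambda>i. xs ! stable_rank w i) [0..<length w]"

lemma length_deal [simp]: "length (deal xs w) = length w"
  by (simp add: deal_def)

lemma distinct_deal:
  assumes "distinct xs" "length w = length xs"
  shows "distinct (deal xs w)"
proof -
  have "stable_rank w i < length xs" if "i < length w" for i
    using stable_rank_less[OF that] assms(2) by simp
  then show ?thesis
    using assms by (auto simp: deal_def distinct_map inj_on_def nth_eq_iff_index_eq stable_rank_inj)
qed

section \<open>Composing two deals\<close>

text \<open>
  The word \<open>w\<close> describes a first deal and the binary word \<open>b\<close> a second one.  The card at position \<open>i\<close>
  after both was at position \<open>stable_rank b i\<close> in between, so the first digit attached to it is the
  one of \<open>w\<close> at that place.  Doubling it and adding \<open>b ! i\<close> encodes the pair of both digits so that the
  order of numbers is the lexicographic one.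
\<close>

definition refine :: "nat list \<Rightarrow> nat list \<Rightarrow> nat list" where
  "refine w b = map (\<lambda>i. 2 * (w ! stable_rank b i) + b ! i) [0..<length b]"

lemma length_refine [simp]: "length (refine w b) = length b"
  by (simp add: refine_def)

lemma binary_digits_less_iff:
  fixes a b c d :: nat
  assumes "b < 2" "d < 2"
  shows "2 * a + b < 2 * c + d \<longleftrightarrow> a < c \<or> a = c \<and> b < d"
    and "2 * a + b = 2 * c + d \<longleftrightarrow> a = c \<and> b = d"
  using assms by presburger+

text \<open>
  In comparing two ranks by \<open>w\<close>, ties are broken by the intermediate position, which is the rank by \<open>b\<close>
  and thus compares first the digits of \<open>b\<close> and then the original positions.  Hence the composed rank
  is the stable rank for the lexicographic order of the digit pairs.
\<close>

lemma stable_rank_refine: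
  assumes w: "length w = n" and b: "b \<in> words n {..<2}" and i: "i < n"
  shows "stable_rank (refine w b) i = stable_rank w (stable_rank b i)"
proof -
  have n: "length b = n" and b2: "\<And>j. j < n \<Longrightarrow> b ! j < 2"
    using b nth_words_less[OF b] by (auto simp: words_def)
  have bij: "bij_betw (stable_rank b) {..<n} {..<n}" using bij_stable_rank[of b] n by simp
  have reindex: "card {j. j < n \<and> Q j} = card {j. j < n \<and> Q (stable_rank b j)}" for Q
  proof -
    have "{j. j < n \<and> Q j} = {j \<in> stable_rank b ` {..<n}. Q j}"
      using bij by (simp add: bij_betw_def)
    also have "\<dots> = stable_rank b ` {j. j < n \<and> Q (stable_rank b j)}" by auto
    finally have "{j. j < n \<and> Q j} = stable_rank b ` {j. j < n \<and> Q (stable_rank b j)}" .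
    moreover have "inj_on (stable_rank b) {j. j < n \<and> Q (stable_rank b j)}"
      using bij by (auto simp: bij_betw_def inj_on_def)
    ultimately show ?thesis by (simp add: card_image)
  qed
  let ?i = "stable_rank b i"
  have "stable_rank w ?i = card {j. j < n \<and> (w ! stable_rank b j < w ! ?i \<or>
      w ! stable_rank b j = w ! ?i \<and> stable_rank b j < ?i)}"
    unfolding stable_rank_def[of w] w by (rule reindex)
  also have "{j. j < n \<and> (w ! stable_rank b j < w ! ?i \<or>
      w ! stable_rank b j = w ! ?i \<and> stable_rank b j < ?i)} =
      {j. j < n \<and> (refine w b ! j < refine w b ! i \<or> refine w b ! j = refine w b ! i \<and> j < i)}"
    using i n by (auto simp: refine_def binary_digits_less_iff b2 stable_rank_mono_iff)
  finally show ?thesis using n by (simp add: stable_rank_def[of "refine w b"])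
qed

lemma deal_deal:
  assumes "length w = n" "b \<in> words n {..<2}"
  shows "deal (deal xs w) b = deal xs (refine w b)"
proof (rule nth_equalityI)
  have n: "length b = n" using assms by (simp add: words_def)
  then show "length (deal (deal xs w) b) = length (deal xs (refine w b))" by (simp add: refine_def)
  fix i assume "i < length (deal (deal xs w) b)"
  then have i: "i < n" using n by simp
  then have "stable_rank b i < n" using stable_rank_less n by metis
  then show "deal (deal xs w) b ! i = deal xs (refine w b) ! i"
    using stable_rank_refine[OF assms i] i assms(1) n by (simp add: deal_def refine_def)
qed

text \<open>
  The parity of the digits gives back \<open>b\<close>; halving them gives \<open>w\<close> permuted by the rank of \<open>b\<close>, which
  gives back \<open>w\<close>.  Since both sides have \<open>(2 * K) ^ n\<close> elements, injectivity is enough.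
  This bijection makes the refined word uniform and thereby drives the induction on the number of
  shuffles.
\<close>

lemma bij_refine:
  "bij_betw (\<lambda>(w, b). refine w b) (words n {..<K} \<times> words n {..<2}) (words n {..<2 * K})"
proof -
  let ?A = "words n {..<K} \<times> words n {..<2::nat}"
  have inj: "inj_on (\<lambda>(w, b). refine w b) ?A"
  proof (rule inj_onI, clarify)
    fix w b w' b'
    assume w: "w \<in> words n {..<K}" "w' \<in> words n {..<K}"
      and b: "b \<in> words n {..<2}" "b' \<in> words n {..<2}" and eq: "refine w b = refine w' b'"
    have len: "length w = n" "length w' = n" "length b = n" "length b' = n"
      using w b by (auto simp: words_def)
    have b2: "b ! i < 2" "b' ! i < 2" if "i < n" for i
      using b that nth_words_less by blast+
    have *: "2 * (w ! stable_rank b i) + b ! i = 2 * (w' ! stable_rank b' i) + b' ! i" if "i < n" for i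
      using arg_cong[OF eq, of "\<lambda>l. l ! i"] that len by (simp add: refine_def)
    have bb: "b = b'"
      using * len b2 by (intro nth_equalityI) (auto simp: binary_digits_less_iff)
    have "w ! k = w' ! k" if k: "k < n" for k
    proof -
      have "k \<in> stable_rank b ` {..<n}" using bij_stable_rank[of b] len k by (auto simp: bij_betw_def)
      then obtain i where "i < n" "k = stable_rank b i" by auto
      then show ?thesis using * bb by auto
    qed
    then show "w = w' \<and> b = b'" using bb len by (auto intro: nth_equalityI)
  qed
  have "refine w b \<in> words n {..<2 * K}" if w: "w \<in> words n {..<K}" and b: "b \<in> words n {..<2}" for w b
  proof -
    have "2 * (w ! stable_rank b i) + b ! i < 2 * K" if i: "i < n" for i
    proof -
      have "stable_rank b i < n" using stable_rank_less[of i b] b i by (simp add: words_def)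
      then have "b ! i < 2" "w ! stable_rank b i < K"
        using nth_words_less[OF b i] nth_words_less[OF w] by auto
      then show ?thesis by linarith
    qed
    then show ?thesis using that by (auto simp: words_def refine_def)
  qed
  then have sub: "(\<lambda>(w, b). refine w b) ` ?A \<subseteq> words n {..<2 * K}" by auto
  have "card ((\<lambda>(w, b). refine w b) ` ?A) = card (words n {..<2 * K})"
    by (simp add: card_image[OF inj] card_cartesian_product card_words power_mult_distrib)
  then have "(\<lambda>(w, b). refine w b) ` ?A = words n {..<2 * K}"
    using sub by (intro card_subset_eq) (auto simp: finite_words)
  then show ?thesis using inj by (simp add: bij_betw_def)
qed

section \<open>A riffle shuffle is dealing by a uniform binary word\<close>

definition zeros :: "nat list \<Rightarrow> nat" where
  "zeros b = length (filter (\<lambda>x. x = 0) b)"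

lemma zeros_altdef: "zeros b = card {i. i < length b \<and> b ! i = 0}"
  by (simp add: zeros_def length_filter_conv_card)

lemma stable_rank_less_zeros_iff:
  assumes "i < length b"
  shows "stable_rank b i < zeros b \<longleftrightarrow> b ! i = 0"
proof
  assume "b ! i = 0"
  then have "{j. j < length b \<and> (b ! j < b ! i \<or> b ! j = b ! i \<and> j < i)} \<subset>
      {j. j < length b \<and> b ! j = 0}"
    using assms by auto
  then show "stable_rank b i < zeros b"
    unfolding stable_rank_def zeros_altdef by (intro psubset_card_mono) auto
next
  assume "stable_rank b i < zeros b"
  then show "b ! i = 0"
  proof (rule contrapos_pp)
    assume "b ! i \<noteq> 0"
    then have "{j. j < length b \<and> b ! j = 0} \<subseteq>
        {j. j < length b \<and> (b ! j < b ! i \<or> b ! j = b ! i \<and> j < i)}" by auto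
    then show "\<not> stable_rank b i < zeros b"
      unfolding stable_rank_def zeros_altdef not_less by (intro card_mono) auto
  qed
qed

text \<open>
  The positions with digit \<open>0\<close> have as ranks exactly the numbers below \<open>zeros b\<close>, and the rank is
  increasing on positions with equal digits.  So each of the two digit classes runs through its pile
  in order.
\<close>

lemma map_stable_rank_filter_digit:
  assumes b: "b \<in> words n {..<2}"
  shows "map (stable_rank b) (filter (\<lambda>i. b ! i = 0) [0..<n]) = [0..<zeros b]"
    and "map (stable_rank b) (filter (\<lambda>i. b ! i \<noteq> 0) [0..<n]) = [zeros b..<n]"
proof -
  have n: "length b = n" and b2: "\<And>i. i < n \<Longrightarrow> b ! i < 2"
    using b nth_words_less[OF b] by (auto simp: words_def)
  have zn: "zeros b \<le> n" using n length_filter_le[of "\<lambda>x. x = 0" b] by (simp add: zeros_def)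
  have bij: "stable_rank b ` {..<n} = {..<n}" using bij_stable_rank[of b] n by (simp add: bij_betw_def)
  have sorted: "sorted_wrt (<) (map (stable_rank b) (filter Q [0..<n]))"
    if "\<And>i j. i < n \<Longrightarrow> j < n \<Longrightarrow> Q i \<Longrightarrow> Q j \<Longrightarrow> b ! i = b ! j" for Q
  proof -
    have "sorted_wrt (<) (filter Q [0..<n])" by (simp add: sorted_wrt_filter)
    then have "sorted_wrt (\<lambda>i j. stable_rank b i < stable_rank b j) (filter Q [0..<n])"
      by (rule sorted_wrt_mono_rel[rotated]) (use that n in \<open>auto simp: stable_rank_mono_iff\<close>)
    then show ?thesis by (simp add: sorted_wrt_map)
  qed
  have lt: "stable_rank b i < zeros b \<longleftrightarrow> b ! i = 0" if "i < n" for i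
    using stable_rank_less_zeros_iff that n by simp
  have "stable_rank b ` {i. i < n \<and> b ! i = 0} = {..<zeros b}"
  proof (intro set_eqI iffI)
    fix k assume "k \<in> {..<zeros b}"
    moreover from this have "k \<in> stable_rank b ` {..<n}" unfolding bij using zn by simp
    ultimately show "k \<in> stable_rank b ` {i. i < n \<and> b ! i = 0}" using lt by auto
  qed (use lt in auto)
  then show "map (stable_rank b) (filter (\<lambda>i. b ! i = 0) [0..<n]) = [0..<zeros b]"
    using sorted[of "\<lambda>i. b ! i = 0"]
    by (intro sorted_distinct_set_unique) (auto simp: strict_sorted_iff atLeast0LessThan)
  have "stable_rank b ` {i. i < n \<and> b ! i \<noteq> 0} = {zeros b..<n}"
  proof (intro set_eqI iffI)
    fix k assume "k \<in> {zeros b..<n}"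
    moreover from this have "k \<in> stable_rank b ` {..<n}" unfolding bij by simp
    ultimately show "k \<in> stable_rank b ` {i. i < n \<and> b ! i \<noteq> 0}" using lt by force
  next
    fix k assume "k \<in> stable_rank b ` {i. i < n \<and> b ! i \<noteq> 0}"
    then show "k \<in> {zeros b..<n}" using lt n stable_rank_less[of _ b] by force
  qed
  moreover have "b ! i = b ! j" if "i < n" "j < n" "b ! i \<noteq> 0" "b ! j \<noteq> 0" for i j
    using b2[of i] b2[of j] that by simp
  ultimately show "map (stable_rank b) (filter (\<lambda>i. b ! i \<noteq> 0) [0..<n]) = [zeros b..<n]"
    using sorted[of "\<lambda>i. b ! i \<noteq> 0"]
    by (intro sorted_distinct_set_unique) (auto simp: strict_sorted_iff)
qed

lemma deal_in_shuffles:
  assumes xs: "distinct xs" and b: "b \<in> words (length xs) {..<2}"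
  shows "deal xs b \<in> shuffles (take (zeros b) xs) (drop (zeros b) xs)"
proof -
  let ?n = "length xs"
  have n: "length b = ?n" using b by (simp add: words_def)
  have zn: "zeros b \<le> ?n" using n length_filter_le[of "\<lambda>x. x = 0" b] by (simp add: zeros_def)
  let ?P = "\<lambda>x. x \<in> set (take (zeros b) xs)"
  have P: "?P (xs ! stable_rank b i) \<longleftrightarrow> b ! i = 0" if "i < ?n" for i
  proof -
    have "stable_rank b i < ?n" using stable_rank_less[of i b] that n by simp
    then have "?P (xs ! stable_rank b i) \<longleftrightarrow> stable_rank b i < zeros b"
      using xs zn by (auto simp: in_set_conv_nth nth_eq_iff_index_eq)
    then show ?thesis using stable_rank_less_zeros_iff that n by simp
  qed
  have "filter ?P (deal xs b) = map (\<lambda>i. xs ! stable_rank b i) (filter (\<lambda>i. b ! i = 0) [0..<?n])"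
    using P n by (auto simp: deal_def filter_map intro!: arg_cong[of _ _ "map _"] filter_cong)
  also have "\<dots> = map ((!) xs) (map (stable_rank b) (filter (\<lambda>i. b ! i = 0) [0..<?n]))" by simp
  also have "\<dots> = take (zeros b) xs"
    unfolding map_stable_rank_filter_digit[OF b] using zn by (intro nth_equalityI) auto
  finally have 1: "filter ?P (deal xs b) = take (zeros b) xs" .
  have "filter (\<lambda>x. \<not> ?P x) (deal xs b) =
      map (\<lambda>i. xs ! stable_rank b i) (filter (\<lambda>i. b ! i \<noteq> 0) [0..<?n])"
    using P n by (auto simp: deal_def filter_map intro!: arg_cong[of _ _ "map _"] filter_cong)
  also have "\<dots> = map ((!) xs) (map (stable_rank b) (filter (\<lambda>i. b ! i \<noteq> 0) [0..<?n]))" by simp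
  also have "\<dots> = drop (zeros b) xs"
    unfolding map_stable_rank_filter_digit[OF b] using zn by (intro nth_equalityI) auto
  finally have 2: "filter (\<lambda>x. \<not> ?P x) (deal xs b) = drop (zeros b) xs" .
  show ?thesis using partition_in_shuffles[of "deal xs b" ?P] by (simp only: 1 2)
qed

lemma card_words_zeros: "card {b \<in> words n {..<2}. zeros b = t} = n choose t"
proof -
  have "{..<2} = {0} \<union> {1::nat}" by auto
  then show ?thesis
    using card_words_filter[of "{0::nat}" "{1}" n t] by (simp add: zeros_def)
qed

text \<open>
  For cards without repetition the deck determines the ranks, and comparing a rank with the common
  number \<open>t\<close> of zeros gives back the digit.  Surjectivity follows because there are \<open>n choose t\<close>
  interleavings and equally many words.
\<close>

lemma bij_deal_shuffles:
  assumes xs: "distinct xs" and t: "t \<le> length xs"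
  shows "bij_betw (deal xs) {b \<in> words (length xs) {..<2}. zeros b = t}
    (shuffles (take t xs) (drop t xs))"
proof -
  let ?W = "{b \<in> words (length xs) {..<2}. zeros b = t}"
  have inj: "inj_on (deal xs) ?W"
  proof (rule inj_onI)
    fix b b' assume b: "b \<in> ?W" "b' \<in> ?W" and eq: "deal xs b = deal xs b'"
    have len: "length b = length xs" "length b' = length xs" using b by (auto simp: words_def)
    have "b ! i = b' ! i" if i: "i < length xs" for i
    proof -
      have "xs ! stable_rank b i = xs ! stable_rank b' i"
        using arg_cong[OF eq, of "\<lambda>l. l ! i"] i len by (simp add: deal_def)
      moreover have "stable_rank b i < length xs" "stable_rank b' i < length xs"
        using stable_rank_less[of i b] stable_rank_less[of i b'] i len by auto
      ultimately have "stable_rank b i = stable_rank b' i" using xs by (simp add: nth_eq_iff_index_eq)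
      then have "b ! i = 0 \<longleftrightarrow> b' ! i = 0"
        using stable_rank_less_zeros_iff[of i b] stable_rank_less_zeros_iff[of i b'] i len b by simp
      moreover have "b ! i < 2" "b' ! i < 2"
        using b i nth_words_less by blast+
      ultimately show ?thesis by linarith
    qed
    then show "b = b'" using len by (auto intro: nth_equalityI)
  qed
  have "deal xs ` ?W \<subseteq> shuffles (take t xs) (drop t xs)"
    using deal_in_shuffles[OF xs] by auto
  moreover have "card (deal xs ` ?W) = card (shuffles (take t xs) (drop t xs))"
    using card_interleavings[OF xs t] by (simp add: card_image[OF inj] card_words_zeros)
  ultimately have "deal xs ` ?W = shuffles (take t xs) (drop t xs)"
    by (intro card_subset_eq) auto
  then show ?thesis using inj by (simp add: bij_betw_def)
qed

text \<open>
  The number of zeros in a uniform binary word has the distribution of the cut, so choosing it first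
  and then a word with that many zeros yields a uniform word: the factor \<open>n choose t\<close> cancels.
\<close>

lemma binary_word_by_zeros:
  "bind_pmf (binomial_pmf n (1/2)) (\<lambda>t. pmf_of_set {b \<in> words n {..<2}. zeros b = t}) =
    pmf_of_set (words n {..<2})"
proof (rule pmf_eqI)
  fix b :: "nat list"
  let ?W = "\<lambda>t. {b \<in> words n {..<2}. zeros b = t}"
  have ne: "?W t \<noteq> {}" if "t \<le> n" for t
    using card_words_zeros[of n t] that by (metis binomial_eq_0_iff card.empty not_less)
  have fin: "finite (?W t)" for t by (simp add: finite_words)
  have "pmf (bind_pmf (binomial_pmf n (1/2)) (\<lambda>t. pmf_of_set (?W t))) b =
      (\<Sum>t\<le>n. pmf (binomial_pmf n (1/2)) t * pmf (pmf_of_set (?W t)) b)"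
    unfolding pmf_bind
    by (subst integral_measure_pmf_real[where A = "{..n}"])
      (auto simp: set_pmf_binomial_eq mult.commute)
  also have "\<dots> = (\<Sum>t\<le>n. if t = zeros b \<and> b \<in> words n {..<2} then 1 / 2 ^ n else 0)"
  proof (rule sum.cong[OF refl])
    fix t assume "t \<in> {..n}"
    then have t: "t \<le> n" by simp
    then have "real (n choose t) \<noteq> 0" by simp
    then show "pmf (binomial_pmf n (1/2)) t * pmf (pmf_of_set (?W t)) b =
        (if t = zeros b \<and> b \<in> words n {..<2} then 1 / 2 ^ n else 0)"
      unfolding cut_probability[OF t] pmf_of_set[OF ne[OF t] fin] card_words_zeros
      by (auto simp: indicator_def)
  qed
  also have "\<dots> = (if b \<in> words n {..<2} then 1 / 2 ^ n else 0)"
  proof (cases "b \<in> words n {..<2}")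
    case True
    then have "zeros b \<le> n"
      using length_filter_le[of "\<lambda>x. x = 0" b] by (simp add: zeros_def words_def)
    then show ?thesis using True by simp
  qed simp
  also have "\<dots> = pmf (pmf_of_set (words n {..<2})) b"
    by (subst pmf_of_set) (auto simp: finite_words card_words words_nonempty lessThan_empty_iff)
  finally show "pmf (bind_pmf (binomial_pmf n (1/2)) (\<lambda>t. pmf_of_set (?W t))) b =
    pmf (pmf_of_set (words n {..<2})) b" .
qed

lemma riffle_shuffle_deal:
  assumes "distinct xs"
  shows "riffle_shuffle xs = map_pmf (deal xs) (pmf_of_set (words (length xs) {..<2}))"
proof -
  let ?n = "length xs"
  let ?W = "\<lambda>t. {b \<in> words ?n {..<2}. zeros b = t}"
  have "map_pmf (deal xs) (pmf_of_set (?W t)) = pmf_of_set (shuffles (take t xs) (drop t xs))"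
    if t: "t \<le> ?n" for t
  proof -
    have "?W t \<noteq> {}"
      using card_words_zeros[of ?n t] t by (metis binomial_eq_0_iff card.empty not_less)
    then show ?thesis
      using bij_deal_shuffles[OF assms t] map_pmf_of_set_inj[of "deal xs" "?W t"]
      by (simp add: bij_betw_def finite_words)
  qed
  then have "riffle_shuffle xs =
      bind_pmf (binomial_pmf ?n (1/2)) (\<lambda>t. map_pmf (deal xs) (pmf_of_set (?W t)))"
    unfolding riffle_shuffle_def by (intro bind_pmf_cong) (auto simp: set_pmf_binomial_eq)
  then show ?thesis by (simp add: map_bind_pmf flip: binary_word_by_zeros)
qed

section \<open>Repeated riffle shuffles\<close>

lemma pair_pmf_of_set:
  assumes "finite A" "finite B" "A \<noteq> {}" "B \<noteq> {}"
  shows "pair_pmf (pmf_of_set A) (pmf_of_set B) = pmf_of_set (A \<times> B)"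
proof (rule pmf_eqI)
  fix z :: "'a \<times> 'b"
  show "pmf (pair_pmf (pmf_of_set A) (pmf_of_set B)) z = pmf (pmf_of_set (A \<times> B)) z"
    using assms by (cases z) (simp add: pmf_pair card_cartesian_product indicator_def)
qed

text \<open>
  Zero shuffles amount to a deal from a single pile, and each further shuffle doubles the number of piles by
  \<open>deal_deal\<close> and \<open>bij_refine\<close>.
\<close>

lemma riffle_shuffles_deal:
  assumes "distinct xs"
  shows "riffle_shuffles k xs = map_pmf (deal xs) (pmf_of_set (words (length xs) {..<2 ^ k}))"
proof (induction k)
  case 0
  have "stable_rank (replicate n (0::nat)) i = i" if "i < n" for i n
  proof -
    have "{j. j < n \<and> (replicate n (0::nat) ! j < replicate n 0 ! i \<or>
        replicate n (0::nat) ! j = replicate n 0 ! i \<and> j < i)} = {..<i}"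
      using that by auto
    then show ?thesis by (simp add: stable_rank_def)
  qed
  then have "deal xs (replicate (length xs) 0) = xs"
    by (intro nth_equalityI) (auto simp: deal_def)
  moreover have "words (length xs) {..<2 ^ 0} = {replicate (length xs) (0::nat)}"
    by (auto simp: words_def intro!: replicate_eqI)
  ultimately show ?case by (simp add: pmf_of_set_singleton)
next
  case (Suc k)
  let ?n = "length xs"
  let ?W = "words ?n {..<2 ^ k :: nat}" and ?B = "words ?n {..<2::nat}"
  have fin: "finite ?W" "finite ?B" "?W \<noteq> {}" "?B \<noteq> {}"
    by (auto simp: finite_words words_nonempty lessThan_empty_iff)
  have "riffle_shuffles (Suc k) xs = bind_pmf (pmf_of_set ?W) (\<lambda>w. riffle_shuffle (deal xs w))"
    by (simp add: Suc.IH bind_map_pmf)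
  also have "\<dots> = bind_pmf (pmf_of_set ?W)
      (\<lambda>w. map_pmf (\<lambda>b. deal xs (refine w b)) (pmf_of_set ?B))"
  proof (rule bind_pmf_cong[OF refl])
    fix w assume "w \<in> set_pmf (pmf_of_set ?W)"
    then have w: "length w = ?n" using fin by (simp add: words_def)
    then have "riffle_shuffle (deal xs w) = map_pmf (deal (deal xs w)) (pmf_of_set ?B)"
      by (simp add: riffle_shuffle_deal distinct_deal assms)
    also have "\<dots> = map_pmf (\<lambda>b. deal xs (refine w b)) (pmf_of_set ?B)"
      using w fin by (intro map_pmf_cong) (auto simp: deal_deal)
    finally show "riffle_shuffle (deal xs w) = map_pmf (\<lambda>b. deal xs (refine w b)) (pmf_of_set ?B)" .
  qed
  also have "\<dots> = map_pmf (deal xs)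
      (map_pmf (\<lambda>(w, b). refine w b) (pair_pmf (pmf_of_set ?W) (pmf_of_set ?B)))"
    by (simp add: pair_pmf_def map_bind_pmf map_pmf_def bind_assoc_pmf bind_return_pmf)
  also have "pair_pmf (pmf_of_set ?W) (pmf_of_set ?B) = pmf_of_set (?W \<times> ?B)"
    using fin by (simp add: pair_pmf_of_set)
  also have "map_pmf (\<lambda>(w, b). refine w b) (pmf_of_set (?W \<times> ?B)) =
      pmf_of_set (words ?n {..<2 ^ Suc k})"
    using bij_refine[of ?n "2 ^ k"] fin by (subst map_pmf_of_set_inj) (auto simp: bij_betw_def)
  finally show ?case .
qed

lemma prob_deck_after:
  "measure_pmf.prob (deck_after k n) {d. P d} =
    card {w \<in> words n {..<2 ^ k}. P (deal [1..<Suc n] w)} / 2 ^ (k * n)"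
proof -
  have "measure_pmf.prob (deck_after k n) {d. P d} =
      measure_pmf.prob (pmf_of_set (words n {..<2 ^ k})) {w. P (deal [1..<Suc n] w)}"
    by (simp add: deck_after_def riffle_shuffles_deal vimage_def del: upt_Suc)
  also have "\<dots> = card (words n {..<2 ^ k} \<inter> {w. P (deal [1..<Suc n] w)}) /
      card (words n {..<2 ^ k :: nat})"
    by (rule measure_pmf_of_set) (auto simp: finite_words words_nonempty lessThan_empty_iff)
  finally show ?thesis by (simp add: Int_def card_words power_mult)
qed

section \<open>The two top cards\<close>

text \<open>
  At position \<open>0\<close> no tie counts, since no position precedes it; at position \<open>1\<close> the only tie that
  counts is the one with position \<open>0\<close>.
\<close>

lemma take_2_deal:
  assumes "length r = N"
  shows "take 2 (deal [1..<Suc (Suc (Suc N))] (x # y # r)) =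
    [Suc (length (filter (\<lambda>z. z < x) (y # r))),
     Suc (length (filter (\<lambda>z. z < y) (x # r)) + (if x = y then 1 else 0))]"
proof -
  let ?w = "x # y # r" and ?n = "Suc (Suc N)"
  have 0: "stable_rank ?w 0 = length (filter (\<lambda>z. z < x) (y # r))"
  proof -
    have "stable_rank ?w 0 = card {j. j < length ?w \<and> ?w ! j < x}"
      by (simp add: stable_rank_def)
    also have "\<dots> = length (filter (\<lambda>z. z < x) ?w)"
      by (simp only: length_filter_conv_card)
    finally show ?thesis by simp
  qed
  have 1: "stable_rank ?w 1 = length (filter (\<lambda>z. z < y) (x # r)) + (if x = y then 1 else 0)"
  proof -
    have "{j. j < length ?w \<and> (?w ! j < ?w ! 1 \<or> ?w ! j = ?w ! 1 \<and> j < 1)} =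
        {j. j < length ?w \<and> ?w ! j < y} \<union> (if x = y then {0} else {})"
      by auto
    moreover have "card ({j. j < length ?w \<and> ?w ! j < y} \<union> (if x = y then {0} else {})) =
        card {j. j < length ?w \<and> ?w ! j < y} + (if x = y then 1 else 0)"
      by (subst card_Un_disjoint) auto
    moreover have "card {j. j < length ?w \<and> ?w ! j < y} = length (filter (\<lambda>z. z < y) ?w)"
      by (simp only: length_filter_conv_card)
    ultimately show ?thesis by (simp add: stable_rank_def)
  qed
  have "stable_rank ?w 0 < ?n" "stable_rank ?w 1 < ?n"
    using stable_rank_less[of 0 ?w] stable_rank_less[of 1 ?w] assms by simp_all
  moreover have "[0..<?n] = 0 # 1 # [2..<?n]" by (simp add: upt_conv_Cons numeral_2_eq_2)
  ultimately show ?thesis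
    using assms by (simp add: deal_def 0[symmetric] 1[symmetric] del: upt_Suc filter.simps)
qed

text \<open>
  For card \<open>1\<close> to come second, its digit \<open>y\<close> must be the least of all and less than \<open>x\<close>.  The top card
  exceeds the total size of the piles before pile \<open>x\<close> by one; these piles hold card \<open>1\<close> and \<open>p\<close>
  cards belonging to later positions, with digits in \<open>{y..<x}\<close>, while the other later digits lie in
  \<open>{x..<K}\<close>.
\<close>

lemma card_words_deal_smaller_next:
  "card {w \<in> words (Suc (Suc N)) {..<K}. take 2 (deal [1..<Suc (Suc (Suc N))] w) = [Suc (Suc p), 1]} =
    (\<Sum>x<K. \<Sum>y<x. (N choose p) * (x - y) ^ p * (K - x) ^ (N - p))"
proof -
  let ?E = "\<lambda>w. take 2 (deal [1..<Suc (Suc (Suc N))] w) = [Suc (Suc p), 1]"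
  have "card {r \<in> words N {..<K}. ?E (x # y # r)} =
      (if y < x then (N choose p) * (x - y) ^ p * (K - x) ^ (N - p) else 0)"
    if xy: "x < K" "y < K" for x y
  proof -
    have E: "?E (x # y # r) \<longleftrightarrow> y < x \<and>
        length (filter (\<lambda>z. z < x) r) = p \<and> filter (\<lambda>z. z < y) r = []"
      if "length r = N" for r
      unfolding take_2_deal[OF that] by auto
    have eq: "{r \<in> words N {..<K}. ?E (x # y # r)} = (if y < x then
        {r \<in> words N ({y..<x} \<union> {x..<K}). length (filter (\<lambda>z. z \<in> {y..<x}) r) = p} else {})"
      (is "?L = ?R")
    proof (intro set_eqI)
      fix r
      have "r \<in> ?L \<longleftrightarrow> r \<in> words N {..<K} \<and> y < x \<and>
          length (filter (\<lambda>z. z < x) r) = p \<and> filter (\<lambda>z. z < y) r = []"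
        using E by (auto simp: words_def)
      moreover have "filter (\<lambda>z. z < x) r = filter (\<lambda>z. z \<in> {y..<x}) r"
        if "filter (\<lambda>z. z < y) r = []"
        using that by (intro filter_cong) (auto simp: filter_empty_conv)
      moreover have "r \<in> words N {..<K} \<and> filter (\<lambda>z. z < y) r = [] \<longleftrightarrow>
          r \<in> words N ({y..<x} \<union> {x..<K})" if "y < x"
        using that xy by (force simp: words_def filter_empty_conv)
      ultimately show "r \<in> ?L \<longleftrightarrow> r \<in> ?R" by auto
    qed
    show ?thesis unfolding eq using card_words_filter[of "{y..<x}" "{x..<K}" N p] by auto
  qed
  then have "card {w \<in> words (Suc (Suc N)) {..<K}. ?E w} =
      (\<Sum>x<K. \<Sum>y<K. if y < x then (N choose p) * (x - y) ^ p * (K - x) ^ (N - p) else 0)"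
    by (simp add: card_words_Suc del: upt_Suc)
  also have "\<dots> = (\<Sum>x<K. \<Sum>y<x. (N choose p) * (x - y) ^ p * (K - x) ^ (N - p))"
    by (intro sum.cong sum.mono_neutral_cong_right) auto
  finally show ?thesis .
qed

text \<open>
  Consecutive cards \<open>p + 1\<close>, \<open>p + 2\<close> either come from the same pile \<open>x = y\<close>, or the first is the whole
  pile \<open>x\<close> and the second is the top of the next nonempty pile \<open>y > x\<close>.  In both cases the later
  digits avoid \<open>{x..<y}\<close>, and exactly \<open>p\<close> of them are below \<open>x\<close>.
\<close>

lemma card_words_deal_consecutive:
  "card {w \<in> words (Suc (Suc N)) {..<K}. take 2 (deal [1..<Suc (Suc (Suc N))] w) = [Suc p, Suc (Suc p)]} =
    (\<Sum>x<K. \<Sum>y=x..<K. (N choose p) * x ^ p * (K - y) ^ (N - p))"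
proof -
  let ?E = "\<lambda>w. take 2 (deal [1..<Suc (Suc (Suc N))] w) = [Suc p, Suc (Suc p)]"
  have "card {r \<in> words N {..<K}. ?E (x # y # r)} =
      (if x \<le> y then (N choose p) * x ^ p * (K - y) ^ (N - p) else 0)"
    if xy: "x < K" "y < K" for x y
  proof -
    have eq: "{r \<in> words N {..<K}. ?E (x # y # r)} = (if x \<le> y then
        {r \<in> words N ({..<x} \<union> {y..<K}). length (filter (\<lambda>z. z \<in> {..<x}) r) = p} else {})"
      (is "?L = ?R")
    proof (cases "x \<le> y")
      case False
      have le: "length (filter (\<lambda>z. z < y) r) \<le> length (filter (\<lambda>z. z < x) r)" for r
        using False by (induction r) auto
      have "\<not> ?E (x # y # r)" if "length r = N" for r
        using False le[of r] unfolding take_2_deal[OF that] by (simp split: if_splits)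
      then show ?thesis using False by (auto simp: words_def simp del: upt_Suc)
    next
      case True
      have len: "length (filter (\<lambda>z. z < y) r) =
          length (filter (\<lambda>z. z < x) r) + length (filter (\<lambda>z. x \<le> z \<and> z < y) r)" for r
        using True by (induction r) auto
      have E: "?E (x # y # r) \<longleftrightarrow> length (filter (\<lambda>z. z < x) r) = p \<and>
          filter (\<lambda>z. x \<le> z \<and> z < y) r = []" if "length r = N" for r
      proof (cases "x = y")
        case True
        then have "filter (\<lambda>z. x \<le> z \<and> z < y) r = []" by (auto simp: filter_empty_conv)
        then show ?thesis unfolding take_2_deal[OF that] using True by simp
      next
        case False
        then have "x < y" using \<open>x \<le> y\<close> by simp
        then show ?thesis unfolding take_2_deal[OF that] by (simp add: len) (metis add_cancel_left_right length_0_conv)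
      qed
      have "r \<in> ?L \<longleftrightarrow> r \<in> ?R" for r
      proof -
        have "r \<in> ?L \<longleftrightarrow> r \<in> words N {..<K} \<and> length (filter (\<lambda>z. z < x) r) = p \<and>
            filter (\<lambda>z. x \<le> z \<and> z < y) r = []"
          using E by (auto simp: words_def)
        moreover have "r \<in> words N {..<K} \<and> filter (\<lambda>z. x \<le> z \<and> z < y) r = [] \<longleftrightarrow>
            r \<in> words N ({..<x} \<union> {y..<K})"
          using True xy by (force simp: words_def filter_empty_conv)
        ultimately show ?thesis using True by auto
      qed
      then show ?thesis by blast
    qed
    have disj: "{..<x} \<inter> {y..<K} = {}" if "x \<le> y" using that by auto
    show ?thesis unfolding eq using card_words_filter[of "{..<x}" "{y..<K}" N p]
      by (auto simp: disj)
  qed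
  then have "card {w \<in> words (Suc (Suc N)) {..<K}. ?E w} =
      (\<Sum>x<K. \<Sum>y<K. if x \<le> y then (N choose p) * x ^ p * (K - y) ^ (N - p) else 0)"
    by (simp add: card_words_Suc del: upt_Suc)
  also have "\<dots> = (\<Sum>x<K. \<Sum>y=x..<K. (N choose p) * x ^ p * (K - y) ^ (N - p))"
    by (intro sum.cong sum.mono_neutral_cong_right) auto
  finally show ?thesis .
qed

section \<open>Changing a strategy at a single history\<close>

text \<open>
  Along a deck, the history \<open>S\<close> can only occur after \<open>length S\<close> cards, so changing the guess at \<open>S\<close>
  affects only that one guess.  The equation adds a term on each side to avoid subtraction.
\<close>

lemma correct_guesses_update:
  assumes "length S < length d"
  shows "real (correct_guesses (G(S := c)) d) + indicator {d. take (Suc (length S)) d = S @ [G S]} d =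
    real (correct_guesses G d) + indicator {d. take (Suc (length S)) d = S @ [c]} d"
proof -
  let ?s = "length S"
  have sum: "real (correct_guesses F d) = of_bool (F (take ?s d) = d ! ?s) +
      (\<Sum>r\<in>{..<length d} - {?s}. of_bool (F (take r d) = d ! r))" for F
  proof -
    have "real (correct_guesses F d) = (\<Sum>r<length d. of_bool (F (take r d) = d ! r))"
      by (simp add: correct_guesses_def sum.If_cases of_bool_def Int_def)
    then show ?thesis using assms by (subst (asm) sum.remove[of _ ?s]) auto
  qed
  have other: "(\<Sum>r\<in>{..<length d} - {?s}. of_bool ((G(S := c)) (take r d) = d ! r)) =
      (\<Sum>r\<in>{..<length d} - {?s}. of_bool (G (take r d) = d ! r) :: real)"
    by (intro sum.cong) auto
  have "take (Suc ?s) d = S @ [e] \<longleftrightarrow> take ?s d = S \<and> d ! ?s = e" for e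
    using assms by (auto simp: take_Suc_conv_app_nth)
  then show ?thesis
    unfolding sum other by (auto simp: indicator_def)
qed

text \<open>
  Replacing the guess at \<open>S\<close> by \<open>c\<close> changes the expectation by exactly the difference of the two
  probabilities.
\<close>

lemma optimal_strategy_best_guess:
  assumes G: "optimal_strategy k n G" and S: "S \<in> histories n" and c: "c \<in> {1..n}"
  shows "measure_pmf.prob (deck_after k n) {d. take (Suc (length S)) d = S @ [c]} \<le>
    measure_pmf.prob (deck_after k n) {d. take (Suc (length S)) d = S @ [G S]}"
proof -
  let ?D = "deck_after k n"
  let ?I = "\<lambda>e. indicator {d. take (Suc (length S)) d = S @ [e]} :: nat list \<Rightarrow> real"
  have int: "integrable ?D f" for f :: "nat list \<Rightarrow> real"
    by (intro integrable_measure_pmf_finite finite_set_deck_after)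
  have "G(S := c) \<in> strategies n"
    using G c by (auto simp: optimal_strategy_def strategies_def)
  then have le: "expected_correct k n (G(S := c)) \<le> expected_correct k n G"
    using G by (simp add: optimal_strategy_def)
  have "measure_pmf.expectation ?D (\<lambda>d. real (correct_guesses (G(S := c)) d) + ?I (G S) d) =
      measure_pmf.expectation ?D (\<lambda>d. real (correct_guesses G d) + ?I c d)"
    using S by (intro integral_cong_AE)
      (auto simp: AE_measure_pmf_iff histories_def set_deck_after_length intro!: correct_guesses_update)
  then have "expected_correct k n (G(S := c)) + measure_pmf.expectation ?D (?I (G S)) =
      expected_correct k n G + measure_pmf.expectation ?D (?I c)"
    by (simp add: expected_correct_def int)
  then show ?thesis using le by simp
qed

section \<open>A history at which the rule fails\<close>

lemma append_in_shuffles: "ys @ xs \<in> shuffles xs ys"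
  by (induction ys) (simp_all add: Cons_in_shuffles_rightI)

lemma possible_history_single:
  assumes "1 \<le> m" "m \<le> n" "2 \<le> n"
  shows "possible_history n [m]"
proof -
  let ?xs = "[1..<Suc n]"
  \<comment> \<open>Cut above card \<open>m\<close> and put the lower pile on top.\<close>
  let ?d = "drop (m - 1) ?xs @ take (m - 1) ?xs"
  have "?d \<in> shuffles (take (m - 1) ?xs) (drop (m - 1) ?xs)"
    by (rule append_in_shuffles)
  moreover have "m - 1 \<le> length ?xs" using assms by simp
  ultimately have "?d \<in> set_pmf (riffle_shuffle ?xs)"
    unfolding set_riffle_shuffle by blast
  then have "?d \<in> set_pmf (deck_after 1 n)"
    by (simp add: deck_after_def bind_return_pmf del: upt_Suc)
  moreover have "drop (m - 1) ?xs = m # [Suc m..<Suc n]"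
    using assms unfolding drop_upt by (subst upt_conv_Cons) auto
  then have "take (length [m]) ?d = [m]" by simp
  ultimately have "measure_pmf.prob (deck_after 1 n) {d. take (length [m]) d = [m]} > 0"
    by (intro measure_pmf_posI) auto
  then show ?thesis using assms by (simp add: possible_history_def histories_def)
qed

theorem corollary5:
  shows "\<exists>(n::nat) (k::nat). n \<ge> 1 \<and> k \<ge> 2 \<and>
    \<not> (\<exists>G. optimal_strategy k n G \<and> follows_longer_subsequence_rule n G)"
proof -
  have False if opt: "optimal_strategy 2 10 G" and rule: "follows_longer_subsequence_rule 10 G" for G
  proof -
    have "possible_history 10 [5]" by (rule possible_history_single) auto
    then have "\<forall>j m T. [5] = [1..<Suc j] @ m # T \<and> m \<noteq> j + 1 \<longrightarrow>
        (let A = {j + 1..<m} - set [5]; B = {m + 1..10} - set [5] in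
          (card A > card B \<longrightarrow> G [5] = Min A) \<and> (card A < card B \<longrightarrow> G [5] = Min B) \<and>
          (card A = card B \<longrightarrow> G [5] = Min A \<or> G [5] = Min B))"
      using rule unfolding follows_longer_subsequence_rule_def by blast
    from this[rule_format, of 0 5 "[]"]
    have "let A = {0 + 1..<5::nat} - set [5]; B = {5 + 1..10} - set [5] in
        card A < card B \<longrightarrow> G [5] = Min B"
      by (simp add: Let_def)
    moreover have "{0 + 1..<5} - set [5] = {1, 2, 3, 4::nat}" by auto
    moreover have "{5 + 1..10} - set [5] = {6, 7, 8, 9, 10::nat}" by auto
    ultimately have G: "G [5] = 6" by (simp add: Let_def)
    \<comment> \<open>The counting lemmas are stated for \<open>Suc (Suc N)\<close> cards with top card \<open>Suc (Suc p)\<close> or \<open>Suc p\<close>;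
      here \<open>N = 8\<close>, and \<open>p\<close> is \<open>3\<close> for card \<open>1\<close> and \<open>4\<close> for card \<open>6\<close>.\<close>
    have prob: "measure_pmf.prob (deck_after 2 (Suc (Suc 8))) {d. take 2 d = l} =
        card {w \<in> words (Suc (Suc 8)) {..<4 :: nat}.
          take 2 (deal [1..<Suc (Suc (Suc 8))] w) = l} / 4 ^ 10" for l
    proof -
      have "(2 :: nat) ^ 2 = 4" "(2 :: real) ^ (2 * Suc (Suc 8)) = 4 ^ 10" by simp_all
      then show ?thesis by (simp only: prob_deck_after)
    qed
    have binomials: "8 choose 3 = 56" "8 choose 4 = 70" by (simp_all add: eval_nat_numeral)
    have sums: "(\<Sum>x<4. \<Sum>y<x. (8 choose 3) * (x - y) ^ 3 * (4 - x) ^ (8 - 3)) = (31752 :: nat)"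
      "(\<Sum>x<4. \<Sum>y=x..<4. (8 choose 4) * x ^ 4 * (4 - y) ^ (8 - 4)) = (31570 :: nat)"
      by (simp_all add: lessThan_nat_numeral atLeastLessThan_nat_numeral binomials)
    have "measure_pmf.prob (deck_after 2 10) {d. take 2 d = [5, 1]} = 31752 / 4 ^ 10"
      using prob[of "[Suc (Suc 3), 1]"] by (simp only: card_words_deal_smaller_next sums) simp
    moreover have "measure_pmf.prob (deck_after 2 10) {d. take 2 d = [5, 6]} = 31570 / 4 ^ 10"
      using prob[of "[Suc 4, Suc (Suc 4)]"] by (simp only: card_words_deal_consecutive sums) simp
    moreover have "measure_pmf.prob (deck_after 2 10) {d. take 2 d = [5, 1]} \<le>
        measure_pmf.prob (deck_after 2 10) {d. take 2 d = [5, 6]}"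
      using optimal_strategy_best_guess[OF opt, of "[5]" 1] G
      by (simp add: histories_def numeral_2_eq_2)
    ultimately show False by simp
  qed
  then show ?thesis by (intro exI[of _ 10] exI[of _ 2]) auto
qed

end
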